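(* Let $G$ be a large group and $p$ a prime. There exists a connected component of $\Gamma_p(G)$ that does not contain any normal subgroup of $G$ as a vertex.
   Context: A group is large if it contains a finite-index subgroup that admits a surjective homomorphism onto a non-cyclic free group. For a group $G$ and a prime $p$, the $p$-local commensurability graph $\Gamma_p(G)$ is the simple graph whose vertices are the finite-index subgroups of $G$, where two distinct vertices $A, B \leq G$ are adjacent if and only if $[A : A\cap B][B : A\cap B]$ is a power of $p$. *)

theory Defs
  imports
    "HOL-Algebra.Elementary_Groups"
    "HOL-Computational_Algebra.Primes"
    "Graph_Theory.Digraph_Component"
begin

section \<open>Free groups\<close>

text \<open>
  The letter \<open>(x, True)\<close> stands for the generator \<open>x\<close>, and \<open>(x, False)\<close> for its formal inverse.
  The free group on \<open>X\<close> consists of the words over these letters, modulo insertion and deletion of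
  adjacent pairs of mutually inverse letters.
\<close>

type_synonym 'x word = "('x \<times> bool) list"

definition words :: "'x set \<Rightarrow> 'x word set"
  where "words X = lists (X \<times> UNIV)"

inductive cancels :: "'x set \<Rightarrow> 'x word \<Rightarrow> 'x word \<Rightarrow> bool" for X
  where "u \<in> words X \<Longrightarrow> v \<in> words X \<Longrightarrow> x \<in> X \<Longrightarrow>
    cancels X (u @ [(x, b), (x, \<not> b)] @ v) (u @ v)"

definition word_rel :: "'x set \<Rightarrow> 'x word rel"
  where "word_rel X = {(u, v). u \<in> words X \<and> v \<in> words X \<and> equivclp (cancels X) u v}"

definition free_group :: "'x set \<Rightarrow> 'x word set monoid"
  where "free_group X =
    \<lparr>carrier = words X // word_rel X,
     monoid.mult = (\<lambda>A B. \<Union>u\<in>A. \<Union>v\<in>B. word_rel X `` {u @ v}),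
     one = word_rel X `` {[]}\<rparr>"

definition free_gen :: "'x set \<Rightarrow> 'x \<Rightarrow> 'x word set"
  where "free_gen X x = word_rel X `` {[(x, True)]}"

subsection \<open>The free group is a group\<close>

lemma words_simps [simp]:
  "[] \<in> words X"
  "l # u \<in> words X \<longleftrightarrow> fst l \<in> X \<and> u \<in> words X"
  "u @ v \<in> words X \<longleftrightarrow> u \<in> words X \<and> v \<in> words X"
  by (auto simp: words_def mem_Times_iff)

lemma cancels_words: "cancels X u v \<Longrightarrow> u \<in> words X \<and> v \<in> words X"
  by (erule cancels.cases) auto

lemma equiv_word_rel: "equiv (words X) (word_rel X)"
  by (rule equivI)
    (auto simp: word_rel_def refl_on_def sym_def trans_def intro: equivclp_sym equivclp_trans)

lemma cancels_append_left: "cancels X u v \<Longrightarrow> w \<in> words X \<Longrightarrow> cancels X (w @ u) (w @ v)"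
  by (erule cancels.cases) (use cancels.intros[of "w @ _" X] in simp)

lemma cancels_append_right: "cancels X u v \<Longrightarrow> w \<in> words X \<Longrightarrow> cancels X (u @ w) (v @ w)"
  by (erule cancels.cases) (use cancels.intros[of _ X "_ @ w"] in simp)

lemma equivclp_map:
  assumes "equivclp R u v" "\<And>u v. R u v \<Longrightarrow> equivclp S (f u) (f v)"
  shows "equivclp S (f u) (f v)"
  using assms(1)
proof (induction rule: equivclp_induct)
  case (step y z)
  then show ?case using assms(2) equivclp_sym equivclp_trans by metis
qed simp

lemma equivclp_invariant:
  assumes "equivclp R u v" "\<And>u v. R u v \<Longrightarrow> f u = f v"
  shows "f u = f v"
  using assms(1) by (induction rule: equivclp_induct) (auto dest: assms(2))

lemma word_rel_append:
  assumes "(u, u') \<in> word_rel X" "(v, v') \<in> word_rel X"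
  shows "(u @ v, u' @ v') \<in> word_rel X"
proof -
  have w: "u \<in> words X" "u' \<in> words X" "v \<in> words X" "v' \<in> words X"
    using assms by (auto simp: word_rel_def)
  have "equivclp (cancels X) (u @ v) (u' @ v)"
    by (rule equivclp_map[where R = "cancels X"])
      (use assms w in \<open>auto simp: word_rel_def intro: r_into_equivclp cancels_append_right\<close>)
  moreover have "equivclp (cancels X) (u' @ v) (u' @ v')"
    by (rule equivclp_map[where R = "cancels X"])
      (use assms w in \<open>auto simp: word_rel_def intro: r_into_equivclp cancels_append_left\<close>)
  ultimately show ?thesis
    using w by (auto simp: word_rel_def intro: equivclp_trans)
qed

lemma free_group_mult:
  assumes "u \<in> words X" "v \<in> words X"
  shows "word_rel X `` {u} \<otimes>\<^bsub>free_group X\<^esub> word_rel X `` {v} = word_rel X `` {u @ v}"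
proof -
  have "congruent2 (word_rel X) (word_rel X) (\<lambda>u v. word_rel X `` {u @ v})"
    by (rule congruent2I')
      (use equiv_class_eq[OF equiv_word_rel] word_rel_append in blast)
  then show ?thesis
    unfolding free_group_def
    by (simp add: UN_equiv_class2[OF equiv_word_rel equiv_word_rel] assms)
qed

lemma carrier_free_group: "carrier (free_group X) = (\<lambda>u. word_rel X `` {u}) ` words X"
  by (auto simp: free_group_def quotient_def)

lemma one_free_group: "\<one>\<^bsub>free_group X\<^esub> = word_rel X `` {[]}"
  by (simp add: free_group_def)

definition inv_word :: "'x word \<Rightarrow> 'x word"
  where "inv_word u = rev (map (\<lambda>(x, b). (x, \<not> b)) u)"

lemma inv_word_words [simp]: "u \<in> words X \<Longrightarrow> inv_word u \<in> words X"
  by (induction u) (auto simp: inv_word_def)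

lemma inv_word_cancel: "u \<in> words X \<Longrightarrow> (inv_word u @ u, []) \<in> word_rel X"
proof (induction u)
  case Nil
  then show ?case by (simp add: inv_word_def word_rel_def)
next
  case (Cons l u)
  obtain x b where l: "l = (x, b)" by (cases l)
  have "cancels X (inv_word (l # u) @ l # u) (inv_word u @ u)"
    using cancels.intros[of "inv_word u" X u x "\<not> b"] Cons.prems
    by (simp add: inv_word_def l inv_word_words[unfolded inv_word_def])
  moreover have "equivclp (cancels X) (inv_word u @ u) []"
    using Cons by (simp add: word_rel_def)
  ultimately show ?case
    using Cons.prems inv_word_words[of "l # u" X]
    by (auto simp: word_rel_def intro: equivclp_trans[OF r_into_equivclp])
qed

lemma group_free_group: "group (free_group X)"
proof (rule groupI)
  fix A assume "A \<in> carrier (free_group X)"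
  then obtain u where u: "u \<in> words X" "A = word_rel X `` {u}"
    by (auto simp: carrier_free_group)
  show "\<exists>B\<in>carrier (free_group X). B \<otimes>\<^bsub>free_group X\<^esub> A = \<one>\<^bsub>free_group X\<^esub>"
  proof
    show "word_rel X `` {inv_word u} \<in> carrier (free_group X)"
      using u by (auto simp: carrier_free_group)
    show "word_rel X `` {inv_word u} \<otimes>\<^bsub>free_group X\<^esub> A = \<one>\<^bsub>free_group X\<^esub>"
      using u equiv_class_eq[OF equiv_word_rel inv_word_cancel[OF u(1)]]
      by (simp add: one_free_group free_group_mult)
  qed
next
  show "\<one>\<^bsub>free_group X\<^esub> \<in> carrier (free_group X)"
    by (auto simp: carrier_free_group one_free_group)
next
  fix A B assume "A \<in> carrier (free_group X)" "B \<in> carrier (free_group X)"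
  then show "A \<otimes>\<^bsub>free_group X\<^esub> B \<in> carrier (free_group X)"
    by (auto simp: carrier_free_group free_group_mult)
next
  fix A assume "A \<in> carrier (free_group X)"
  then show "\<one>\<^bsub>free_group X\<^esub> \<otimes>\<^bsub>free_group X\<^esub> A = A"
    by (auto simp: carrier_free_group one_free_group free_group_mult)
next
  fix A B C
  assume "A \<in> carrier (free_group X)" "B \<in> carrier (free_group X)" "C \<in> carrier (free_group X)"
  then show "A \<otimes>\<^bsub>free_group X\<^esub> B \<otimes>\<^bsub>free_group X\<^esub> C =
      A \<otimes>\<^bsub>free_group X\<^esub> (B \<otimes>\<^bsub>free_group X\<^esub> C)"
    by (auto simp: carrier_free_group free_group_mult)
qed

lemma free_gen_in_carrier: "x \<in> X \<Longrightarrow> free_gen X x \<in> carrier (free_group X)"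
  by (auto simp: free_gen_def carrier_free_group)

subsection \<open>Universal property\<close>

definition eval_word :: "('a, 'b) monoid_scheme \<Rightarrow> ('x \<Rightarrow> 'a) \<Rightarrow> 'x word \<Rightarrow> 'a"
  where "eval_word G s u =
    foldr (\<lambda>(x, b) g. (if b then s x else inv\<^bsub>G\<^esub> s x) \<otimes>\<^bsub>G\<^esub> g) u \<one>\<^bsub>G\<^esub>"

lemma eval_word_simps [simp]:
  "eval_word G s [] = \<one>\<^bsub>G\<^esub>"
  "eval_word G s ((x, b) # u) = (if b then s x else inv\<^bsub>G\<^esub> s x) \<otimes>\<^bsub>G\<^esub> eval_word G s u"
  by (simp_all add: eval_word_def)

lemma (in group) eval_word_closed:
  "s ` X \<subseteq> carrier G \<Longrightarrow> u \<in> words X \<Longrightarrow> eval_word G s u \<in> carrier G"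
  by (induction u) (auto simp: image_subset_iff)

lemma (in group) eval_word_append:
  "s ` X \<subseteq> carrier G \<Longrightarrow> u \<in> words X \<Longrightarrow> v \<in> words X \<Longrightarrow>
    eval_word G s (u @ v) = eval_word G s u \<otimes> eval_word G s v"
  by (induction u) (auto simp: image_subset_iff m_assoc eval_word_closed[of s X])

lemma (in group) eval_word_rel:
  assumes "s ` X \<subseteq> carrier G" "(u, v) \<in> word_rel X"
  shows "eval_word G s u = eval_word G s v"
proof (rule equivclp_invariant[where R = "cancels X"])
  show "equivclp (cancels X) u v" using assms by (simp add: word_rel_def)
next
  fix u v assume "cancels X u v"
  then show "eval_word G s u = eval_word G s v"
  proof cases
    case (1 u' v' x b)
    then have "eval_word G s ([(x, b), (x, \<not> b)] @ v') = eval_word G s v'"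
      using assms(1) eval_word_closed[of s X v'] by (auto simp: image_subset_iff m_assoc[symmetric])
    moreover have "[(x, b), (x, \<not> b)] @ v' \<in> words X"
      using 1 by simp
    ultimately show ?thesis
      using 1 assms(1) by (simp only: eval_word_append[of s X])
  qed
qed

theorem (in group) free_group_universal:
  assumes s: "s ` X \<subseteq> carrier G"
  obtains h where "h \<in> hom (free_group X) G" "\<And>x. x \<in> X \<Longrightarrow> h (free_gen X x) = s x"
    "\<And>u. u \<in> words X \<Longrightarrow> h (word_rel X `` {u}) = eval_word G s u"
proof -
  define h where "h A = the_elem (eval_word G s ` A)" for A
  have h: "h (word_rel X `` {u}) = eval_word G s u" if u: "u \<in> words X" for u
  proof -
    have "eval_word G s ` (word_rel X `` {u}) = {eval_word G s u}"
    proof (rule equalityI)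
      show "eval_word G s ` (word_rel X `` {u}) \<subseteq> {eval_word G s u}"
        by (auto dest: eval_word_rel[OF s])
      show "{eval_word G s u} \<subseteq> eval_word G s ` (word_rel X `` {u})"
        using equiv_class_self[OF equiv_word_rel u] by (simp add: imageI)
    qed
    then show ?thesis by (simp add: h_def)
  qed
  moreover have "h (free_gen X x) = s x" if "x \<in> X" for x
    using that s by (auto simp: free_gen_def h image_subset_iff)
  moreover have "h \<in> hom (free_group X) G"
    by (rule homI)
      (auto simp: carrier_free_group h free_group_mult eval_word_closed[OF s] eval_word_append[OF s])
  ultimately show thesis using that[of h] by blast
qed

lemma hom_eval_word:
  assumes "group H" "h \<in> hom (free_group X) H" "u \<in> words X"
  shows "h (word_rel X `` {u}) = eval_word H (\<lambda>x. h (free_gen X x)) u"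
  using assms(3)
proof (induction u)
  case Nil
  then show ?case using hom_one[OF assms(2) group_free_group assms(1)] by (simp add: one_free_group)
next
  case (Cons l u)
  obtain x b where l: "l = (x, b)" by (cases l)
  interpret group_hom "free_group X" H h
    using assms group_free_group by (simp add: group_hom_def group_hom_axioms_def)
  have x: "x \<in> X" and u: "u \<in> words X" using Cons.prems l by auto
  have "word_rel X `` {[(x, False)]} = inv\<^bsub>free_group X\<^esub> free_gen X x"
  proof (rule G.inv_equality[symmetric])
    show "word_rel X `` {[(x, False)]} \<otimes>\<^bsub>free_group X\<^esub> free_gen X x = \<one>\<^bsub>free_group X\<^esub>"
      using x equiv_class_eq[OF equiv_word_rel inv_word_cancel[of "[(x, True)]" X]]
      by (simp add: free_gen_def free_group_mult one_free_group inv_word_def)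
  qed (use x free_gen_in_carrier[of x X] in \<open>auto simp: carrier_free_group\<close>)
  then have "h (word_rel X `` {[l]}) = (if b then h (free_gen X x) else inv\<^bsub>H\<^esub> h (free_gen X x))"
    using x l by (auto simp: free_gen_def[symmetric] free_gen_in_carrier)
  moreover have "word_rel X `` {l # u} = word_rel X `` {[l]} \<otimes>\<^bsub>free_group X\<^esub> word_rel X `` {u}"
    using x u l by (simp add: free_group_mult)
  moreover have "word_rel X `` {[l]} \<in> carrier (free_group X)" "word_rel X `` {u} \<in> carrier (free_group X)"
    using x u l by (auto simp: carrier_free_group)
  ultimately show ?case using Cons.IH[OF u] l by simp
qed

lemma free_group_hom_ident:
  assumes "m \<in> hom (free_group X) (free_group X)" "\<And>x. x \<in> X \<Longrightarrow> m (free_gen X x) = free_gen X x"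
    and "A \<in> carrier (free_group X)"
  shows "m A = A"
proof -
  obtain u where u: "u \<in> words X" "A = word_rel X `` {u}"
    using assms(3) by (auto simp: carrier_free_group)
  have "eval_word (free_group X) (\<lambda>x. m (free_gen X x)) u
      = eval_word (free_group X) (\<lambda>x. id (free_gen X x)) u"
    using u(1) assms(2) by (induction u) auto
  moreover have "id \<in> hom (free_group X) (free_group X)"
    by (simp add: hom_def)
  ultimately show ?thesis
    using hom_eval_word[OF group_free_group assms(1) u(1)]
      hom_eval_word[OF group_free_group _ u(1), of id] u(2) by simp
qed

lemma inj_on_free_gen: "inj_on (free_gen X) X"
proof (rule inj_onI)
  fix x y assume xy: "x \<in> X" "y \<in> X" "free_gen X x = free_gen X y"
  interpret I: group integer_group by simp
  obtain h where "\<And>z. z \<in> X \<Longrightarrow> h (free_gen X z) = (if z = x then 1 else 0 :: int)"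
    by (rule I.free_group_universal[of "\<lambda>z. if z = x then 1 else 0" X]) auto
  then show "x = y" using xy by (metis zero_neq_one)
qed

section \<open>Large groups\<close>

definition finite_index_subgroup :: "'a set \<Rightarrow> ('a, 'b) monoid_scheme \<Rightarrow> bool"
  where "finite_index_subgroup H G \<longleftrightarrow> subgroup H G \<and> finite (rcosets\<^bsub>G\<^esub> H)"

text \<open>
  The free groups range over the subsets of the carrier type only; by \<open>largeI\<close> below this is no
  restriction, since a basis of a free quotient of \<open>H\<close> lifts injectively to \<open>H\<close>.
\<close>

definition large :: "('a, 'b) monoid_scheme \<Rightarrow> bool"
  where "large G \<longleftrightarrow>
    (\<exists>H (X :: 'a set). finite_index_subgroup H G \<and>
      \<not> cyclic_group (free_group X) \<and> epi (G\<lparr>carrier := H\<rparr>) (free_group X) \<noteq> {})"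

lemma largeI:
  fixes G :: "('a, 'b) monoid_scheme" and X :: "'x set"
  assumes "group G" "finite_index_subgroup H G"
    and "\<not> cyclic_group (free_group X)" "f \<in> epi (G\<lparr>carrier := H\<rparr>) (free_group X)"
  shows "large G"
proof -
  interpret F: group "free_group X" by (rule group_free_group)
  have f: "f \<in> hom (G\<lparr>carrier := H\<rparr>) (free_group X)" "f ` H = carrier (free_group X)"
    using assms(4) by (simp_all add: epi_def)
  have "\<exists>g\<in>H. f g = free_gen X x" if "x \<in> X" for x
    using free_gen_in_carrier[OF that] f(2) by (metis imageE)
  then obtain s where s: "\<And>x. x \<in> X \<Longrightarrow> s x \<in> H \<and> f (s x) = free_gen X x"
    by metis
  have inj: "inj_on s X"
    by (rule inj_onI) (metis s inj_on_free_gen inj_onD)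
  define Y where "Y = s ` X"
  interpret FY: group "free_group Y" by (rule group_free_group)
  have "(\<lambda>x. free_gen Y (s x)) ` X \<subseteq> carrier (free_group Y)"
    by (auto simp: Y_def intro: free_gen_in_carrier)
  then obtain h where h: "h \<in> hom (free_group X) (free_group Y)"
      "\<And>x. x \<in> X \<Longrightarrow> h (free_gen X x) = free_gen Y (s x)"
    by (rule FY.free_group_universal) blast
  have "(\<lambda>y. free_gen X (the_inv_into X s y)) ` Y \<subseteq> carrier (free_group X)"
    by (auto simp: Y_def the_inv_into_f_f[OF inj] intro: free_gen_in_carrier)
  then obtain k where k: "k \<in> hom (free_group Y) (free_group X)"
      "\<And>y. y \<in> Y \<Longrightarrow> k (free_gen Y y) = free_gen X (the_inv_into X s y)"
    by (rule F.free_group_universal) blast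
  have hk: "h (k A) = A" if "A \<in> carrier (free_group Y)" for A
  proof -
    have "(h \<circ> k) (free_gen Y y) = free_gen Y y" if "y \<in> Y" for y
      using that h(2) k(2) by (auto simp: Y_def the_inv_into_f_f[OF inj])
    then show ?thesis
      using free_group_hom_ident[OF Group.hom_compose[OF k(1) h(1)] _ that] by simp
  qed
  have kh: "k (h A) = A" if "A \<in> carrier (free_group X)" for A
  proof -
    have "(k \<circ> h) (free_gen X x) = free_gen X x" if "x \<in> X" for x
      using that h(2) k(2) by (simp add: Y_def the_inv_into_f_f[OF inj])
    then show ?thesis
      using free_group_hom_ident[OF Group.hom_compose[OF h(1) k(1)] _ that] by simp
  qed
  have himg: "h ` carrier (free_group X) = carrier (free_group Y)"
    and kimg: "k ` carrier (free_group Y) = carrier (free_group X)"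
    using hom_in_carrier[OF h(1)] hom_in_carrier[OF k(1)] hk kh
    by (metis image_eqI image_subsetI subset_antisym subsetI)+
  then have kepi: "k \<in> epi (free_group Y) (free_group X)"
    using k(1) by (simp add: epi_def)
  have "\<not> cyclic_group (free_group Y)"
    using FY.cyclic_group_epimorphic_image[OF kepi] assms(3) F.is_group by blast
  moreover have "h \<circ> f \<in> epi (G\<lparr>carrier := H\<rparr>) (free_group Y)"
  proof -
    have "(h \<circ> f) ` H = carrier (free_group Y)"
      by (simp only: image_comp[symmetric] f(2) himg)
    then show ?thesis using Group.hom_compose[OF f(1) h(1)] by (simp add: epi_def)
  qed
  ultimately show ?thesis
    unfolding large_def using assms(2) by blast
qed

section \<open>The local commensurability graph\<close>

abbreviation subgroup_index :: "('a, 'b) monoid_scheme \<Rightarrow> 'a set \<Rightarrow> 'a set \<Rightarrow> nat"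
  where "subgroup_index G A B \<equiv> card (rcosets\<^bsub>G\<lparr>carrier := A\<rparr>\<^esub> B)"

text \<open>Each undirected edge is represented by the two opposite arcs between its ends.\<close>

definition local_commensurability_graph ::
    "nat \<Rightarrow> ('a, 'b) monoid_scheme \<Rightarrow> 'a set pair_pre_digraph"
  where "local_commensurability_graph p G =
    \<lparr>pverts = {A. finite_index_subgroup A G},
     parcs = {(A, B). finite_index_subgroup A G \<and> finite_index_subgroup B G \<and> A \<noteq> B \<and>
       (\<exists>k. subgroup_index G A (A \<inter> B) * subgroup_index G B (A \<inter> B) = p ^ k)}\<rparr>"

lemma pair_bidirected_local_commensurability_graph:
  "pair_bidirected_digraph (local_commensurability_graph p G)"
  by unfold_locales
    (auto simp: local_commensurability_graph_def symmetric_def sym_def Int_commute mult.commute)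

definition connected_component :: "('v, 'e) pre_digraph \<Rightarrow> ('v, 'e) pre_digraph \<Rightarrow> bool"
  where "connected_component \<Gamma> C \<longleftrightarrow>
    pre_digraph.max_subgraph \<Gamma> Digraph_Component.connected C"

end

theory Submission
  imports Defs
begin

text \<open>
  Let \<open>H\<close> be a subgroup of finite index \<open>n\<close> in \<open>G\<close> that maps onto a non-cyclic free group, and let
  \<open>q\<close> be a prime larger than \<open>p\<close> and \<open>n\<close>. A non-cyclic free group has two distinct generators, so
  it maps onto every group generated by two elements, in particular onto the Heisenberg group \<open>P\<close>
  over \<open>\<int>/q\<close>. This is a group of order \<open>q\<^sup>3\<close> with a subgroup \<open>S\<close> that is not normal. Let
  \<open>h : H \<rightarrow> P\<close> be the resulting epimorphism.

  The image \<open>h (A \<inter> H)\<close> depends only on the connected component of the vertex \<open>A\<close>. Indeed, if \<open>C \<le> A\<close>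
  has index a power of \<open>p\<close>, then comparing two ways to compute \<open>[A : C \<inter> H]\<close> shows that
  \<open>[A \<inter> H : C \<inter> H]\<close> divides \<open>[A : C] [C : C \<inter> H]\<close>. The first factor is a power of \<open>p\<close> and the second
  one is at most \<open>n\<close>, so \<open>q\<close> divides neither. But the index of \<open>h (C \<inter> H)\<close> in \<open>h (A \<inter> H)\<close> divides
  \<open>[A \<inter> H : C \<inter> H]\<close> and is a power of \<open>q\<close>, hence is \<open>1\<close>. For adjacent \<open>A\<close> and \<open>B\<close> this applies to
  \<open>C = A \<inter> B\<close> on both sides (\<open>image_Int_eq_if_adjacent\<close>).

  Now consider the component of the preimage of \<open>S\<close>, on which the invariant is \<open>S\<close>. If a normal
  subgroup \<open>N\<close> of \<open>G\<close> were in it, then \<open>S = h (N \<inter> H)\<close> would be normal in \<open>P\<close>, because \<open>N \<inter> H\<close> is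
  normal in \<open>H\<close> and \<open>h\<close> is onto (\<open>component_without_normal_subgroups\<close>).
\<close>

section \<open>Components of symmetric digraphs\<close>

text \<open>
  The reachable set induces a maximal strongly connected subgraph, whereas
  \<^const>\<open>connected_component\<close> asks for maximality among all connected subgraphs. Such a subgraph need
  not be symmetric, but adjacent vertices of its symmetric closure are adjacent in the symmetric
  graph \<open>G\<close>, so its vertices are reachable in \<open>G\<close> all the same.
\<close>

lemma (in sym_digraph) connected_component_reachable:
  assumes u: "u \<in> verts G"
  shows "connected_component G (G \<restriction> {v. u \<rightarrow>\<^sup>* v})"
proof -
  let ?C = "G \<restriction> {v. u \<rightarrow>\<^sup>* v}"
  have sub: "subgraph ?C G"
    by (rule induced_imp_subgraph) (auto elim: reachable_in_vertsE)
  have "max_subgraph strongly_connected ?C"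
    using induce_reachable_is_in_sccs[OF u] by (simp add: sccs_altdef2)
  then have sc: "strongly_connected ?C"
    by (rule max_subgraph_prop)
  interpret C: wf_digraph ?C by (rule wellformed_induce_subgraph)
  have conn: "connected ?C"
    using sc C.reachable_mk_symmetricI
    by (auto simp: connected_def strongly_connected_def)
  have "\<not> connected H" if H: "?C \<noteq> H" "subgraph ?C H" "subgraph H G" for H
  proof
    assume cH: "connected H"
    have uH: "u \<in> verts H" using H(2) u by (auto elim!: subgraphE)
    have "u \<rightarrow>\<^sup>* v" if v: "v \<in> verts H" for v
    proof -
      have "u \<rightarrow>\<^sup>*\<^bsub>mk_symmetric H\<^esub> v"
        using cH uH v by (simp add: connected_def strongly_connected_def)
      then have "u \<rightarrow>\<^sup>*\<^bsub>mk_symmetric G\<^esub> v"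
        using subgraph_mk_symmetric[OF H(3)] by (rule pre_digraph.reachable_mono)
      then show ?thesis using reachable_mk_symmetric_eq[OF sym_arcs] by simp
    qed
    then have V: "verts H = verts ?C"
      using H(2) by (auto elim!: subgraphE)
    interpret H: wf_digraph H using H(2) by (auto elim!: subgraphE)
    have ends: "tail H = tail G" "head H = head G"
      using H(3) by (auto simp: subgraph_def compatible_def)
    have "arcs H = arcs ?C"
    proof
      show "arcs ?C \<subseteq> arcs H" using H(2) by (rule subgraphE)
      have "arcs H \<subseteq> arcs G" using H(3) by (rule subgraphE)
      then show "arcs H \<subseteq> arcs ?C"
        using H.wellformed V ends by fastforce
    qed
    then have "H = ?C" using V ends by simp
    then show False using H(1) by simp
  qed
  then show ?thesis
    unfolding connected_component_def by (intro max_subgraphI conn sub)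
qed

section \<open>Indices of subgroups\<close>

lemma (in group) rcos_eq_iff:
  assumes "subgroup C G" "a \<in> carrier G" "b \<in> carrier G"
  shows "C #> a = C #> b \<longleftrightarrow> a \<otimes> inv b \<in> C"
  using assms by (metis is_group rcos_self repr_independence subgroup.rcos_module)

lemma rcosets_carrier_update:
  "rcosets\<^bsub>G\<lparr>carrier := A\<rparr>\<^esub> C = (\<lambda>a. C #>\<^bsub>G\<^esub> a) ` A"
  by (auto simp: RCOSETS_def r_coset_def)

text \<open>
  The cosets of \<open>C\<close> in \<open>A\<close> are in bijection with pairs of cosets, so the product formula covers infinite
  indices too: there both sides are \<open>0\<close>.
\<close>

lemma (in group) subgroup_index_tower:
  assumes C: "subgroup C G" and D: "subgroup D G" and A: "subgroup A G"
    and CD: "C \<subseteq> D" and DA: "D \<subseteq> A"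
  shows "subgroup_index G A C = subgroup_index G A D * subgroup_index G D C"
proof -
  have carr: "A \<subseteq> carrier G" "D \<subseteq> carrier G" "C \<subseteq> carrier G"
    using A D C by (auto dest: subgroup.subset)
  \<comment> \<open>A coset \<open>Y = D r\<close> in \<open>A\<close> and a coset \<open>C d\<close> in \<open>D\<close> are combined to \<open>C d r\<close>, for a fixed choice of
    representatives \<open>r\<close>.\<close>
  define r where "r Y = (SOME a. a \<in> A \<and> Y = D #> a)" for Y
  have r: "r Y \<in> A" "D #> r Y = Y" if "Y \<in> rcosets\<^bsub>G\<lparr>carrier := A\<rparr>\<^esub> D" for Y
  proof -
    have "\<exists>a. a \<in> A \<and> Y = D #> a"
      using that by (auto simp: rcosets_carrier_update)
    then show "r Y \<in> A" "D #> r Y = Y"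
      unfolding r_def by (metis (mono_tags, lifting) someI_ex)+
  qed
  let ?f = "\<lambda>(Y, Z). Z #> r Y"
  have "bij_betw ?f ((rcosets\<^bsub>G\<lparr>carrier := A\<rparr>\<^esub> D) \<times> (rcosets\<^bsub>G\<lparr>carrier := D\<rparr>\<^esub> C))
      (rcosets\<^bsub>G\<lparr>carrier := A\<rparr>\<^esub> C)"
    unfolding bij_betw_def
  proof (intro conjI inj_onI equalityI subsetI)
    fix s t
    assume s: "s \<in> (rcosets\<^bsub>G\<lparr>carrier := A\<rparr>\<^esub> D) \<times> (rcosets\<^bsub>G\<lparr>carrier := D\<rparr>\<^esub> C)"
      and t: "t \<in> (rcosets\<^bsub>G\<lparr>carrier := A\<rparr>\<^esub> D) \<times> (rcosets\<^bsub>G\<lparr>carrier := D\<rparr>\<^esub> C)"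
      and eq: "?f s = ?f t"
    obtain Y d where s': "s = (Y, C #> d)" "d \<in> D" "Y \<in> rcosets\<^bsub>G\<lparr>carrier := A\<rparr>\<^esub> D"
      using s by (auto simp: rcosets_carrier_update)
    obtain Y' d' where t': "t = (Y', C #> d')" "d' \<in> D" "Y' \<in> rcosets\<^bsub>G\<lparr>carrier := A\<rparr>\<^esub> D"
      using t by (auto simp: rcosets_carrier_update)
    have el: "d \<in> carrier G" "d' \<in> carrier G" "r Y \<in> carrier G" "r Y' \<in> carrier G"
      using s' t' r carr by auto
    have "C #> (d \<otimes> r Y) = C #> (d' \<otimes> r Y')"
      using eq s'(1) t'(1) el carr by (simp add: coset_mult_assoc)
    then have c: "(d \<otimes> r Y) \<otimes> inv (d' \<otimes> r Y') \<in> C"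
      using rcos_eq_iff[OF C] el by simp
    then have "D #> (d \<otimes> r Y) = D #> (d' \<otimes> r Y')"
      using rcos_eq_iff[OF D] CD el by (meson m_closed subsetD)
    moreover have "D #> (d \<otimes> r Y) = D #> r Y" "D #> (d' \<otimes> r Y') = D #> r Y'"
      using el carr s'(2) t'(2) coset_join2[OF _ D] by (simp_all flip: coset_mult_assoc)
    ultimately have YY: "Y = Y'" using r s'(3) t'(3) by simp
    have "(d \<otimes> r Y) \<otimes> inv (d' \<otimes> r Y) = d \<otimes> inv d'"
      using el by (simp add: inv_mult_group m_assoc) (simp add: m_assoc[symmetric])
    then have "C #> d = C #> d'" using c YY rcos_eq_iff[OF C] el by simp
    then show "s = t" using s' t' YY by simp
  next
    fix X
    assume "X \<in> ?f ` ((rcosets\<^bsub>G\<lparr>carrier := A\<rparr>\<^esub> D) \<times> (rcosets\<^bsub>G\<lparr>carrier := D\<rparr>\<^esub> C))"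
    then obtain Y d where Y: "d \<in> D" "Y \<in> rcosets\<^bsub>G\<lparr>carrier := A\<rparr>\<^esub> D" "X = (C #> d) #> r Y"
      by (auto simp: rcosets_carrier_update)
    have "X = C #> (d \<otimes> r Y)"
      using Y r[OF Y(2)] carr by (simp add: coset_mult_assoc subset_iff)
    moreover have "d \<otimes> r Y \<in> A"
      using Y(1) DA r[OF Y(2)] A by (auto intro: subgroup.m_closed)
    ultimately show "X \<in> rcosets\<^bsub>G\<lparr>carrier := A\<rparr>\<^esub> C"
      by (auto simp: rcosets_carrier_update)
  next
    fix X assume "X \<in> rcosets\<^bsub>G\<lparr>carrier := A\<rparr>\<^esub> C"
    then obtain a where a: "a \<in> A" "X = C #> a"
      by (auto simp: rcosets_carrier_update)
    define Y where "Y = D #> a"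
    have Y: "Y \<in> rcosets\<^bsub>G\<lparr>carrier := A\<rparr>\<^esub> D"
      using a by (auto simp: Y_def rcosets_carrier_update)
    have el: "a \<in> carrier G" "r Y \<in> carrier G" using a r[OF Y] carr by auto
    have d: "a \<otimes> inv r Y \<in> D"
      using rcos_eq_iff[OF D el] r[OF Y] Y_def by simp
    have "X = (C #> (a \<otimes> inv r Y)) #> r Y"
      using el carr a(2) by (simp add: coset_mult_assoc m_assoc)
    then show "X \<in> ?f ` ((rcosets\<^bsub>G\<lparr>carrier := A\<rparr>\<^esub> D) \<times> (rcosets\<^bsub>G\<lparr>carrier := D\<rparr>\<^esub> C))"
      using Y d by (force simp: rcosets_carrier_update)
  qed
  then show ?thesis
    using bij_betw_same_card card_cartesian_product by metis
qed

text \<open>Distinct cosets of \<open>C \<inter> H\<close> in \<open>C\<close> lie in distinct cosets of \<open>H\<close>.\<close>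

lemma (in group) subgroup_index_Int_le:
  assumes H: "finite_index_subgroup H G" and C: "subgroup C G"
  shows "0 < subgroup_index G C (C \<inter> H)" "subgroup_index G C (C \<inter> H) \<le> card (rcosets H)"
proof -
  have Hs: "subgroup H G" and fin: "finite (rcosets H)"
    using H by (auto simp: finite_index_subgroup_def)
  have CH: "subgroup (C \<inter> H) G" using C Hs by (rule subgroups_Inter_pair)
  have carr: "C \<subseteq> carrier G" using C by (rule subgroup.subset)
  \<comment> \<open>The coset of \<open>H\<close> that contains the coset \<open>X\<close> of \<open>C \<inter> H\<close>.\<close>
  define f where "f X = H <#> X" for X
  have f: "f ((C \<inter> H) #> c) = H #> c" if "c \<in> C" for c
  proof -
    have "H <#> (C \<inter> H) = H"
    proof
      show "H <#> (C \<inter> H) \<subseteq> H"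
        using subgroup.m_closed[OF Hs] by (auto simp: set_mult_def)
      show "H \<subseteq> H <#> (C \<inter> H)"
      proof
        fix x assume x: "x \<in> H"
        have "x \<in> {x \<otimes> \<one>}" using subgroup.mem_carrier[OF Hs x] by simp
        then show "x \<in> H <#> (C \<inter> H)"
          unfolding set_mult_def by (intro UN_I[OF x] UN_I[OF subgroup.one_closed[OF CH]])
      qed
    qed
    then show ?thesis
      unfolding f_def using that carr Hs CH
      by (metis in_mono setmult_rcos_assoc subgroup.subset)
  qed
  have inj: "inj_on f (rcosets\<^bsub>G\<lparr>carrier := C\<rparr>\<^esub> (C \<inter> H))"
  proof (rule inj_onI)
    fix X Y
    assume "X \<in> rcosets\<^bsub>G\<lparr>carrier := C\<rparr>\<^esub> (C \<inter> H)" "Y \<in> rcosets\<^bsub>G\<lparr>carrier := C\<rparr>\<^esub> (C \<inter> H)"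
      and eq: "f X = f Y"
    then obtain x y where xy: "x \<in> C" "y \<in> C" "X = (C \<inter> H) #> x" "Y = (C \<inter> H) #> y"
      by (auto simp: rcosets_carrier_update)
    then have "H #> x = H #> y" using eq f by simp
    then have "x \<otimes> inv y \<in> H" using rcos_eq_iff[OF Hs] xy carr by blast
    moreover have "x \<otimes> inv y \<in> C"
      using xy C by (auto intro: subgroup.m_closed subgroup.m_inv_closed)
    ultimately show "X = Y" using rcos_eq_iff[OF CH] xy carr by blast
  qed
  have img: "f ` (rcosets\<^bsub>G\<lparr>carrier := C\<rparr>\<^esub> (C \<inter> H)) \<subseteq> rcosets H"
    using f carr by (auto simp: rcosets_carrier_update RCOSETS_def)
  show "subgroup_index G C (C \<inter> H) \<le> card (rcosets H)"
    using inj img fin by (rule card_inj_on_le)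
  have "finite (rcosets\<^bsub>G\<lparr>carrier := C\<rparr>\<^esub> (C \<inter> H))"
    using inj img fin by (meson finite_imageD finite_subset)
  moreover have "rcosets\<^bsub>G\<lparr>carrier := C\<rparr>\<^esub> (C \<inter> H) \<noteq> {}"
    using C by (auto simp: rcosets_carrier_update dest: subgroup.one_closed)
  ultimately show "0 < subgroup_index G C (C \<inter> H)"
    by (simp add: card_gt_0_iff)
qed

lemma (in group_hom) subgroup_preimage:
  assumes "subgroup T H"
  shows "subgroup {x \<in> carrier G. h x \<in> T} G"
proof (rule G.subgroupI)
  show "{x \<in> carrier G. h x \<in> T} \<noteq> {}"
    using subgroup.one_closed[OF assms] G.one_closed hom_one by (metis (mono_tags) empty_iff mem_Collect_eq)
qed (use assms in \<open>auto intro: subgroup.m_closed subgroup.m_inv_closed\<close>)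

lemma (in group_hom) card_rcosets_preimage:
  assumes T: "subgroup T H" and surj: "h ` carrier G = carrier H"
  shows "card (rcosets {x \<in> carrier G. h x \<in> T}) = card (rcosets\<^bsub>H\<^esub> T)"
proof -
  let ?D = "{x \<in> carrier G. h x \<in> T}"
  have D: "subgroup ?D G" using T by (rule subgroup_preimage)
  have T': "h ` ?D = T"
    using surj subgroup.subset[OF T] by auto
  have im: "h ` (?D #> a) = T #>\<^bsub>H\<^esub> h a" if a: "a \<in> carrier G" for a
  proof -
    have "h ` (?D #> a) = (\<lambda>t. t \<otimes>\<^bsub>H\<^esub> h a) ` h ` ?D"
      using a by (auto simp: r_coset_def image_iff)
    then show ?thesis by (auto simp: T' r_coset_def)
  qed
  have "bij_betw (image h) (rcosets ?D) (rcosets\<^bsub>H\<^esub> T)"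
    unfolding bij_betw_def
  proof
    show "inj_on (image h) (rcosets ?D)"
    proof (rule inj_onI)
      fix X Y assume "X \<in> rcosets ?D" "Y \<in> rcosets ?D" and eq: "h ` X = h ` Y"
      then obtain x y where xy: "x \<in> carrier G" "y \<in> carrier G" "X = ?D #> x" "Y = ?D #> y"
        by (auto simp: RCOSETS_def)
      then have "T #>\<^bsub>H\<^esub> h x = T #>\<^bsub>H\<^esub> h y" using eq im by simp
      then have "h x \<otimes>\<^bsub>H\<^esub> inv\<^bsub>H\<^esub> h y \<in> T" using H.rcos_eq_iff[OF T] xy by simp
      then have "x \<otimes> inv y \<in> ?D" using xy by simp
      then show "X = Y" using G.rcos_eq_iff[OF D] xy by simp
    qed
    have "image h ` (rcosets ?D) = (\<lambda>a. h ` (?D #> a)) ` carrier G"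
      by (auto simp: RCOSETS_def)
    also have "\<dots> = (\<lambda>a. T #>\<^bsub>H\<^esub> h a) ` carrier G"
      using im by (rule image_cong[OF refl])
    also have "\<dots> = (\<lambda>t. T #>\<^bsub>H\<^esub> t) ` carrier H"
      by (simp only: surj[symmetric] image_image)
    also have "\<dots> = rcosets\<^bsub>H\<^esub> T"
      by (auto simp: RCOSETS_def)
    finally show "image h ` (rcosets ?D) = rcosets\<^bsub>H\<^esub> T" .
  qed
  then show ?thesis by (rule bij_betw_same_card)
qed

text \<open>
  The index of \<open>h ` S\<close> in \<open>h ` K\<close> is a power of \<open>q\<close> because the target is a \<open>q\<close>-group, and it divides
  the index of \<open>S\<close> in \<open>K\<close>, because it is the index in \<open>K\<close> of a subgroup \<open>D\<close> between the two: the
  preimage of \<open>h ` S\<close> in \<open>K\<close>.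
\<close>

lemma (in group_hom) image_eq_if_coprime_index:
  assumes P: "order H = q ^ k" "prime q"
    and S: "subgroup S G" and K: "subgroup K G" and SK: "S \<subseteq> K"
    and q: "\<not> q dvd subgroup_index G K S"
  shows "h ` S = h ` K"
proof -
  let ?GK = "G\<lparr>carrier := K\<rparr>" and ?HK = "H\<lparr>carrier := h ` K\<rparr>"
  have hK: "subgroup (h ` K) H" and hS: "subgroup (h ` S) H"
    using K S by (auto intro: subgroup_img_is_subgroup)
  interpret hK: group ?HK using hK by (rule H.subgroup_imp_group)
  interpret K: group ?GK using K by (rule G.subgroup_imp_group)
  have carr: "K \<subseteq> carrier G" using K by (rule subgroup.subset)
  interpret hom_K: group_hom ?GK ?HK h
    by unfold_locales (use carr in \<open>auto simp: hom_def subset_iff\<close>)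
  let ?D = "{x \<in> K. h x \<in> h ` S}"
  have hSK: "subgroup (h ` S) ?HK"
    using hS hK SK by (intro H.subgroup_incl) auto
  have DK: "subgroup ?D ?GK"
    using hom_K.subgroup_preimage[OF hSK] by simp
  have D: "subgroup ?D G" using G.incl_subgroup[OF K DK] .
  have "subgroup_index G K S = subgroup_index G K ?D * subgroup_index G ?D S"
    using S D K SK by (intro G.subgroup_index_tower) auto
  moreover have "subgroup_index G K ?D = card (rcosets\<^bsub>?HK\<^esub> (h ` S))"
    using hom_K.card_rcosets_preimage[OF hSK] by simp
  ultimately have nd: "\<not> q dvd card (rcosets\<^bsub>?HK\<^esub> (h ` S))"
    using q by auto
  have "card (rcosets\<^bsub>?HK\<^esub> (h ` S)) dvd order ?HK"
    using hK.lagrange[OF hSK] by (metis dvd_triv_left)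
  also have "order ?HK dvd order H"
    using H.lagrange[OF hK] by (simp add: order_def) (metis dvd_triv_right)
  finally obtain i where i: "card (rcosets\<^bsub>?HK\<^esub> (h ` S)) = q ^ i"
    using P by (auto simp: divides_primepow_nat)
  then have "i = 0" using nd by (cases i) auto
  then have one: "card (rcosets\<^bsub>?HK\<^esub> (h ` S)) = 1" using i by simp
  have fin: "finite (carrier H)"
    using P prime_gt_0_nat H.order_gt_0_iff_finite by simp
  have "card (h ` S) = card (h ` K)"
    using hK.lagrange[OF hSK] one by (simp add: order_def)
  moreover have "finite (h ` K)" using fin hK by (meson finite_subset subgroup.subset)
  ultimately show ?thesis using SK by (intro card_subset_eq) auto
qed

section \<open>An invariant of the components\<close>

text \<open>
  As \<open>H\<close> may fail to be normal, \<open>[A \<inter> H : C \<inter> H]\<close> may fail to divide \<open>[A : C]\<close>. It divides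
  \<open>[A : C] [C : C \<inter> H]\<close>, however, and the new factor is prime to \<open>q\<close> because it is positive and at most
  the index of \<open>H\<close>.
\<close>

lemma (in group) image_Int_eq_if_coprime_index:
  assumes H: "finite_index_subgroup H G" and q: "prime q" "card (rcosets H) < q"
    and P: "group P" "order P = q ^ k" and h: "h \<in> hom (G\<lparr>carrier := H\<rparr>) P"
    and A: "subgroup A G" and C: "subgroup C G" "C \<subseteq> A"
    and nd: "\<not> q dvd subgroup_index G A C"
  shows "h ` (C \<inter> H) = h ` (A \<inter> H)"
proof -
  have Hs: "subgroup H G" using H by (simp add: finite_index_subgroup_def)
  interpret hom: group_hom "G\<lparr>carrier := H\<rparr>" P h
    using P h Hs by (simp add: group_hom_def group_hom_axioms_def subgroup_imp_group)
  have AH: "subgroup (A \<inter> H) G" and CH: "subgroup (C \<inter> H) G"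
    using A C Hs by (auto intro: subgroups_Inter_pair)
  have "subgroup_index G A (A \<inter> H) * subgroup_index G (A \<inter> H) (C \<inter> H)
      = subgroup_index G A (C \<inter> H)"
    using C(2) by (intro subgroup_index_tower[OF CH AH A, symmetric]) auto
  also have "\<dots> = subgroup_index G A C * subgroup_index G C (C \<inter> H)"
    using C(2) by (intro subgroup_index_tower[OF CH C(1) A]) auto
  finally have *: "subgroup_index G A (A \<inter> H) * subgroup_index G (A \<inter> H) (C \<inter> H)
      = subgroup_index G A C * subgroup_index G C (C \<inter> H)" .
  have "\<not> q dvd subgroup_index G C (C \<inter> H)"
    using subgroup_index_Int_le[OF H C(1)] q(2) by (auto dest: dvd_imp_le)
  then have "\<not> q dvd subgroup_index G A C * subgroup_index G C (C \<inter> H)"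
    using nd q(1) by (simp add: prime_dvd_mult_iff)
  then have "\<not> q dvd subgroup_index G (A \<inter> H) (C \<inter> H)"
    unfolding *[symmetric] by auto
  moreover have "subgroup (C \<inter> H) (G\<lparr>carrier := H\<rparr>)" "subgroup (A \<inter> H) (G\<lparr>carrier := H\<rparr>)"
    using AH CH Hs by (auto intro: subgroup_incl)
  ultimately show ?thesis
    using hom.image_eq_if_coprime_index[OF P(2) q(1), of "C \<inter> H" "A \<inter> H"] C(2) by auto
qed

lemma (in group) image_Int_eq_if_adjacent:
  assumes H: "finite_index_subgroup H G" and q: "prime q" "card (rcosets H) < q"
    and p: "prime p" "p \<noteq> q"
    and P: "group P" "order P = q ^ k" and h: "h \<in> hom (G\<lparr>carrier := H\<rparr>) P"
    and adj: "(A, B) \<in> parcs (local_commensurability_graph p G)"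
  shows "h ` (A \<inter> H) = h ` (B \<inter> H)"
proof -
  obtain i where i: "subgroup_index G A (A \<inter> B) * subgroup_index G B (A \<inter> B) = p ^ i"
    and AB: "subgroup A G" "subgroup B G"
    using adj by (auto simp: local_commensurability_graph_def finite_index_subgroup_def)
  have "\<not> q dvd p ^ i"
    using p q(1) prime_dvd_power[of q p i] primes_dvd_imp_eq[of q p] by auto
  then have nd: "\<not> q dvd subgroup_index G A (A \<inter> B)" "\<not> q dvd subgroup_index G B (A \<inter> B)"
    unfolding i[symmetric] by auto
  have "subgroup (A \<inter> B) G" using AB by (rule subgroups_Inter_pair)
  then show ?thesis
    using image_Int_eq_if_coprime_index[OF H q P h AB(1) _ _ nd(1)]
      image_Int_eq_if_coprime_index[OF H q P h AB(2) _ _ nd(2)] by simp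
qed

text \<open>
  The component is that of the preimage of \<open>S\<close>: all its vertices \<open>B\<close> satisfy \<open>h ` (B \<inter> H) = S\<close>.
\<close>

lemma (in group) component_without_normal_subgroups:
  assumes H: "finite_index_subgroup H G" and q: "prime q" "card (rcosets H) < q"
    and p: "prime p" "p \<noteq> q"
    and P: "group P" "order P = q ^ k" and h: "h \<in> epi (G\<lparr>carrier := H\<rparr>) P"
    and S: "subgroup S P" "\<not> S \<lhd> P"
  shows "\<exists>C. connected_component (with_proj (local_commensurability_graph p G)) C \<and>
    (\<forall>N \<in> verts C. \<not> N \<lhd> G)"
proof -
  let ?\<Gamma> = "local_commensurability_graph p G"
  interpret \<Gamma>: pair_bidirected_digraph ?\<Gamma>
    by (rule pair_bidirected_local_commensurability_graph)
  have Hs: "subgroup H G" and Hf: "finite (rcosets H)"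
    using H by (auto simp: finite_index_subgroup_def)
  have hom: "h \<in> hom (G\<lparr>carrier := H\<rparr>) P" and surj: "h ` H = carrier P"
    using h by (auto simp: epi_def)
  interpret h: group_hom "G\<lparr>carrier := H\<rparr>" P h
    using P hom Hs by (simp add: group_hom_def group_hom_axioms_def subgroup_imp_group)
  define A where "A = {x \<in> H. h x \<in> S}"
  have AH: "subgroup A (G\<lparr>carrier := H\<rparr>)"
    using h.subgroup_preimage[OF S(1)] by (simp add: A_def)
  have A: "subgroup A G" using incl_subgroup[OF Hs AH] .
  have finP: "finite (carrier P)"
    using P(2) q(1) prime_gt_0_nat h.H.order_gt_0_iff_finite by simp
  have "subgroup_index G H A = card (rcosets\<^bsub>P\<^esub> S)"
    using h.card_rcosets_preimage[OF S(1)] surj by (simp add: A_def)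
  moreover have "card (rcosets\<^bsub>P\<^esub> S) * card S \<noteq> 0"
    using h.H.lagrange[OF S(1)] P(2) q(1) by simp
  moreover have "card (rcosets H) \<noteq> 0"
    using Hf rcosetsI[OF subgroup.subset[OF Hs] one_closed] by auto
  moreover have "card (rcosets A) = card (rcosets H) * subgroup_index G H A"
    using subgroup_index_tower[OF A Hs subgroup_self _ subgroup.subset[OF Hs]] by (simp add: A_def)
  ultimately have "card (rcosets A) \<noteq> 0" by simp
  then have "finite (rcosets A)" by (rule contrapos_np) simp
  then have AV: "A \<in> pverts ?\<Gamma>"
    using A by (simp add: local_commensurability_graph_def finite_index_subgroup_def)
  let ?C = "with_proj ?\<Gamma> \<restriction> {B. A \<rightarrow>\<^sup>*\<^bsub>with_proj ?\<Gamma>\<^esub> B}"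
  have inv: "h ` (B \<inter> H) = S" if "A \<rightarrow>\<^sup>*\<^bsub>with_proj ?\<Gamma>\<^esub> B" for B
    using that
  proof (induction rule: \<Gamma>.reachable_induct)
    case base
    have "A \<inter> H = A" by (auto simp: A_def)
    moreover have "h ` A = S"
      using surj subgroup.subset[OF S(1)] by (auto simp: A_def)
    ultimately show ?case by simp
  next
    case (step B B')
    then have "(B, B') \<in> parcs ?\<Gamma>" by simp
    then show ?case using image_Int_eq_if_adjacent[OF H q p P hom] step.IH by blast
  qed
  have "\<not> N \<lhd> G" if "N \<in> verts ?C" for N
  proof
    assume "N \<lhd> G"
    then have "N \<inter> H \<lhd> G\<lparr>carrier := H\<rparr>" by (rule normal_Int_subgroup[OF Hs])
    then have "h ` (N \<inter> H) \<lhd> P"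
      by (rule normal.surj_hom_normal_subgroup) (use h.group_hom_axioms surj in auto)
    then show False using inv[of N] that S(2) by simp
  qed
  then show ?thesis using \<Gamma>.connected_component_reachable[OF AV] by blast
qed

section \<open>Non-cyclic free groups map onto Heisenberg groups\<close>

text \<open>
  The triple \<open>(a, b, c)\<close> stands for the upper unitriangular \<open>3 \<times> 3\<close> matrix over \<open>\<int>/n\<close> with \<open>a\<close>, \<open>b\<close>
  above the diagonal and \<open>c\<close> in the corner; residues are represented in \<open>{0..<n}\<close>.
\<close>

definition heisenberg_group :: "int \<Rightarrow> (int \<times> int \<times> int) monoid"
  where "heisenberg_group n =
    \<lparr>carrier = {0..<n} \<times> {0..<n} \<times> {0..<n},
     monoid.mult = (\<lambda>(a, b, c) (a', b', c').
       ((a + a') mod n, (b + b') mod n, (c + c' + a * b') mod n)),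
     one = (0, 0, 0)\<rparr>"

lemma heisenberg_simps [simp]:
  "carrier (heisenberg_group n) = {0..<n} \<times> {0..<n} \<times> {0..<n}"
  "(a, b, c) \<otimes>\<^bsub>heisenberg_group n\<^esub> (a', b', c') =
    ((a + a') mod n, (b + b') mod n, (c + c' + a * b') mod n)"
  "\<one>\<^bsub>heisenberg_group n\<^esub> = (0, 0, 0)"
  by (simp_all add: heisenberg_group_def)

lemma group_heisenberg:
  assumes "n > 0"
  shows "group (heisenberg_group n)"
proof (rule groupI)
  fix x assume "x \<in> carrier (heisenberg_group n)"
  then obtain a b c where x: "x = (a, b, c)" "0 \<le> a" "a < n" "0 \<le> b" "b < n" "0 \<le> c" "c < n"
    by auto
  have "((a * b - c) mod n + c + (- a) mod n * b) mod n = ((a * b - c) + c + (- a) * b) mod n"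
    by (intro mod_add_cong mod_mult_cong) auto
  then have "((- a) mod n, (- b) mod n, (a * b - c) mod n) \<otimes>\<^bsub>heisenberg_group n\<^esub> x
      = \<one>\<^bsub>heisenberg_group n\<^esub>"
    using x by (simp add: mod_simps)
  moreover have "((- a) mod n, (- b) mod n, (a * b - c) mod n) \<in> carrier (heisenberg_group n)"
    using assms by simp
  ultimately show "\<exists>y\<in>carrier (heisenberg_group n). y \<otimes>\<^bsub>heisenberg_group n\<^esub> x
      = \<one>\<^bsub>heisenberg_group n\<^esub>"
    by blast
next
  fix x y z :: "int \<times> int \<times> int"
  obtain a b c a' b' c' a'' b'' c'' where xyz: "x = (a, b, c)" "y = (a', b', c')" "z = (a'', b'', c'')"
    by (metis prod_cases3)
  have "((c + c' + a * b') mod n + c'' + (a + a') mod n * b'') mod n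
      = ((c + c' + a * b') + c'' + (a + a') * b'') mod n"
    by (intro mod_add_cong mod_mult_cong) auto
  also have "\<dots> = (c + (c' + c'' + a' * b'') + a * (b' + b'')) mod n"
    by (simp add: algebra_simps)
  also have "\<dots> = (c + (c' + c'' + a' * b'') mod n + a * ((b' + b'') mod n)) mod n"
    by (intro mod_add_cong mod_mult_cong) auto
  finally show "x \<otimes>\<^bsub>heisenberg_group n\<^esub> y \<otimes>\<^bsub>heisenberg_group n\<^esub> z =
      x \<otimes>\<^bsub>heisenberg_group n\<^esub> (y \<otimes>\<^bsub>heisenberg_group n\<^esub> z)"
    by (simp add: xyz mod_simps add.assoc)
qed (use assms in \<open>auto simp: mod_simps\<close>)

lemma order_heisenberg: "order (heisenberg_group (int q)) = q ^ 3"
  by (simp add: order_def card_cartesian_product power3_eq_cube)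

text \<open>
  Conjugating \<open>(1, 0, 0)\<close> by \<open>(0, 1, 0)\<close> changes the corner entry to \<open>- 1\<close>.
\<close>

lemma heisenberg_subgroup_not_normal:
  assumes n: "n > 1"
  shows "subgroup ({0..<n} \<times> {0} \<times> {0}) (heisenberg_group n)" (is "subgroup ?S ?P")
    and "\<not> {0..<n} \<times> {0} \<times> {0} \<lhd> heisenberg_group n"
proof -
  interpret P: group ?P using n by (intro group_heisenberg) simp
  have inv: "inv\<^bsub>?P\<^esub> (a, 0, 0) = ((- a) mod n, 0, 0)" if "0 \<le> a" "a < n" for a
    by (rule P.inv_equality) (use that n in \<open>auto simp: mod_simps\<close>)
  show "subgroup ?S ?P"
    by (rule P.subgroupI) (use n inv in auto)
  show "\<not> ?S \<lhd> ?P"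
  proof
    assume "?S \<lhd> ?P"
    then have "(0, 1, 0) \<otimes>\<^bsub>?P\<^esub> (1, 0, 0) \<otimes>\<^bsub>?P\<^esub> inv\<^bsub>?P\<^esub> (0, 1, 0) \<in> ?S"
      by (rule normal.inv_op_closed2) (use n in auto)
    moreover have "inv\<^bsub>?P\<^esub> (0, 1, 0) = (0, (- 1) mod n, 0)"
      by (rule P.inv_equality) (use n in \<open>auto simp: mod_simps\<close>)
    ultimately show False using n by (simp add: zmod_minus1)
  qed
qed

text \<open>
  With \<open>x = (1, 0, 0)\<close> and \<open>y = (0, 1, 0)\<close>, moving a power \<open>y\<^sup>c\<close> from the left of \<open>x\<close> to its right adds \<open>c\<close>
  to the corner entry. So \<open>(a, b, c)\<close> is the product, in this order, of \<open>y\<close> to the power \<open>b - c\<close>,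
  \<open>x\<close>, \<open>y\<close> to the power \<open>c\<close> and \<open>x\<close> to the power \<open>a - 1\<close>.
\<close>

lemma free_group_epi_heisenberg:
  assumes X: "x \<in> X" "y \<in> X" "x \<noteq> y" and n: "n > 1"
  shows "epi (free_group X) (heisenberg_group n) \<noteq> {}"
proof -
  let ?F = "free_group X" and ?P = "heisenberg_group n"
  interpret P: group ?P using n by (intro group_heisenberg) simp
  define s :: "_ \<Rightarrow> int \<times> int \<times> int"
    where "s z = (if z = x then (1, 0, 0) else if z = y then (0, 1, 0) else (0, 0, 0))" for z
  have "s ` X \<subseteq> carrier ?P" using n by (auto simp: s_def)
  then obtain h where h: "h \<in> hom ?F ?P" "\<And>z. z \<in> X \<Longrightarrow> h (free_gen X z) = s z"
    by (rule P.free_group_universal) blast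
  interpret h: group_hom ?F ?P h
    using h(1) group_free_group P.is_group by (simp add: group_hom_def group_hom_axioms_def)
  let ?x = "free_gen X x" and ?y = "free_gen X y"
  have xy: "?x \<in> carrier ?F" "?y \<in> carrier ?F" using X by (auto intro: free_gen_in_carrier)
  have hxy: "h ?x = (1, 0, 0)" "h ?y = (0, 1, 0)" using X h(2) by (auto simp: s_def)
  have powx: "(1, 0, 0) [^]\<^bsub>?P\<^esub> (k :: nat) = (int k mod n, 0, 0)" for k
    using n by (induction k) (auto simp: mod_simps add.commute)
  have powy: "(0, 1, 0) [^]\<^bsub>?P\<^esub> (k :: nat) = (0, int k mod n, 0)" for k
    using n by (induction k) (auto simp: mod_simps add.commute)
  have "carrier ?P \<subseteq> h ` carrier ?F"
  proof
    fix t assume "t \<in> carrier ?P"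
    then obtain a b c where t: "t = (a, b, c)" "0 \<le> a" "a < n" "0 \<le> b" "b < n" "0 \<le> c" "c < n"
      by auto
    obtain i j k where ijk: "int i = (b - c) mod n" "int j = c" "int k = (a - 1) mod n"
      using t(6) n zero_le_imp_eq_int pos_mod_sign by (metis less_trans zero_less_one)
    define w where "w = ?y [^]\<^bsub>?F\<^esub> i \<otimes>\<^bsub>?F\<^esub> ?x \<otimes>\<^bsub>?F\<^esub> ?y [^]\<^bsub>?F\<^esub> j \<otimes>\<^bsub>?F\<^esub> ?x [^]\<^bsub>?F\<^esub> k"
    have "w \<in> carrier ?F" using xy by (simp add: w_def)
    moreover have "h w = t"
      using n t xy by (simp add: w_def h.hom_nat_pow hxy powx powy ijk mod_simps)
    ultimately show "t \<in> h ` carrier ?F" by blast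
  qed
  then have "h ` carrier ?F = carrier ?P" using h.hom_closed by blast
  then have "h \<in> epi ?F ?P" using h(1) by (simp add: epi_def)
  then show ?thesis by blast
qed

text \<open>
  Every word is a power of the generator belonging to \<open>x\<close>; if \<open>X\<close> is empty, the unit element takes its
  place.
\<close>

lemma cyclic_free_group:
  assumes "X \<subseteq> {x}"
  shows "cyclic_group (free_group X)"
proof -
  let ?F = "free_group X"
  interpret F: group ?F by (rule group_free_group)
  define g where "g = (if x \<in> X then free_gen X x else \<one>\<^bsub>?F\<^esub>)"
  have g: "g \<in> carrier ?F" by (auto simp: g_def free_gen_in_carrier)
  have "word_rel X `` {u} \<in> range (\<lambda>n::int. g [^]\<^bsub>?F\<^esub> n)" if "u \<in> words X" for u
  proof -
    have "word_rel X `` {u} = eval_word ?F (\<lambda>z. id (free_gen X z)) u"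
      using hom_eval_word[OF F.is_group _ that, of id] by (simp add: hom_def)
    also have "\<dots> \<in> range (\<lambda>n::int. g [^]\<^bsub>?F\<^esub> n)"
      using that
    proof (induction u)
      case Nil
      show ?case by (auto intro: range_eqI[of _ _ 0])
    next
      case (Cons l u)
      then obtain b n where l: "l = (x, b)" "x \<in> X"
        and n: "eval_word ?F (\<lambda>z. id (free_gen X z)) u = g [^]\<^bsub>?F\<^esub> (n::int)"
        using assms by (cases l) auto
      have "(if b then g else inv\<^bsub>?F\<^esub> g) = g [^]\<^bsub>?F\<^esub> (if b then 1 else - 1 :: int)"
        using g by (simp add: F.int_pow_neg)
      then have "eval_word ?F (\<lambda>z. id (free_gen X z)) (l # u) = g [^]\<^bsub>?F\<^esub> ((if b then 1 else - 1) + n)"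
        using F.int_pow_mult[OF g] l n by (simp add: g_def split: if_splits)
      then show ?case by blast
    qed
    finally show ?thesis .
  qed
  then have "carrier ?F \<subseteq> range (\<lambda>n::int. g [^]\<^bsub>?F\<^esub> n)"
    by (auto simp: carrier_free_group)
  then have "carrier ?F = range (\<lambda>n::int. g [^]\<^bsub>?F\<^esub> n)"
    using F.int_pow_closed[OF g] by blast
  then show ?thesis using g F.cyclic_group by blast
qed

theorem corollary22:
  fixes G :: "('a, 'b) monoid_scheme" and p :: nat
  assumes "group G" and "large G" and "prime p"
  shows "\<exists>C. connected_component (with_proj (local_commensurability_graph p G)) C \<and>
    (\<forall>N \<in> verts C. \<not> N \<lhd> G)"
proof -
  interpret G: group G by fact
  obtain H and X :: "'a set" and f where H: "finite_index_subgroup H G"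
    and X: "\<not> cyclic_group (free_group X)" and f: "f \<in> epi (G\<lparr>carrier := H\<rparr>) (free_group X)"
    using \<open>large G\<close> unfolding large_def by blast
  obtain x y where xy: "x \<in> X" "y \<in> X" "x \<noteq> y"
    using X cyclic_free_group by (metis empty_subsetI insertI1 subsetI singletonD)
  obtain q where q: "prime q" "max p (card (rcosets\<^bsub>G\<^esub> H)) < q"
    using bigger_prime by blast
  let ?P = "heisenberg_group (int q)"
  have q1: "int q > 1" using q(1) prime_gt_1_nat by simp
  obtain g where g: "g \<in> epi (free_group X) ?P"
    using free_group_epi_heisenberg[OF xy q1] by blast
  have "g \<circ> f \<in> epi (G\<lparr>carrier := H\<rparr>) ?P"
    using epi_compose[OF f g] .
  then show ?thesis
    using G.component_without_normal_subgroups[OF H q(1) _ \<open>prime p\<close> _ group_heisenberg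
        order_heisenberg _ heisenberg_subgroup_not_normal[OF q1]] q(2) q1 by auto
qed

end
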